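(* Let $G$ be a compact Lie group and let $\mathcal{C}$ be a set of closed subgroups of $G$ which is closed under conjugacy. If $p: X \to Y$ is a map of $G$-spaces and there exists a $G$-equivariant open cover $\{U_i\}_{i \in I}$ of $Y$ (that is, an open cover by $G$-invariant open subspaces) such that $p: p^{-1}(U_i) \to U_i$ is a $\mathcal{C}$-fibration for all $i \in I$, then $p$ is a $\mathcal{C}$-fibration.
   Context: All spaces are compactly generated weak Hausdorff, and all maps of $G$-spaces are $G$-equivariant. A $\mathcal{C}$-fibration is a $G$-map $p$ such that the fixed-point map $p^H$ is a Serre fibration for every $H\in\mathcal{C}$; equivalently, it is a $G$-map with the right lifting property with respect to the maps $G/H\times D^n\to G/H\times D^n\times [0,1]$ (inclusion at $0$) for all $n\ge 0$ and $H\in\mathcal{C}$. *)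

theory Defs
  imports "HOL-Analysis.Analysis" "HOL-Algebra.Group_Action"
begin

section \<open>Compactly generated weak Hausdorff spaces\<close>

text \<open>
  In both definitions the test space \<open>K\<close> ought to range over all compact Hausdorff spaces.
  As HOL cannot quantify over types, \<open>K\<close> ranges over those carried by subsets of
  \<^typ>\<open>'a set set\<close>; this is no restriction for compactly generated weak Hausdorff spaces.

  Given \<open>f : K \<rightarrow> X\<close>, choose a set \<open>D\<close> containing one preimage of each point of
  \<open>f(K)\<close>. The closure \<open>K'\<close> of \<open>D\<close> is compact Hausdorff, \<open>f(K') = f(K)\<close>, and \<open>K'\<close> has at most
  \<open>2^(2^|X|)\<close> points, as \<open>D\<close> is dense in it. So \<open>K'\<close> embeds in \<^typ>\<open>'a set set\<close>, and
  \<open>weak_hausdorff\<close> is the usual notion. In a weak Hausdorff space \<open>f(K)\<close> is a compact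
  Hausdorff subspace and \<open>K \<rightarrow> f(K)\<close> is a quotient map, so \<open>S \<inter> f(K)\<close> is closed in \<open>f(K)\<close> iff
  the preimage of \<open>S\<close> is closed in \<open>K\<close>; hence the inclusions of such subspaces already detect
  the \<open>k\<close>-closed sets.

  The library's \<^const>\<open>k_space\<close> tests on compact subspaces that need not be Hausdorff, so it
  is a different notion.
\<close>

definition weak_hausdorff :: "'a topology \<Rightarrow> bool" where
  "weak_hausdorff X \<longleftrightarrow>
    (\<forall>(K :: 'a set set topology) f.
      compact_space K \<and> Hausdorff_space K \<and> continuous_map K X f
        \<longrightarrow> closedin X (f ` topspace K))"

definition compactly_generated :: "'a topology \<Rightarrow> bool" where
  "compactly_generated X \<longleftrightarrow>
    (\<forall>S \<subseteq> topspace X.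
      (\<forall>(K :: 'a set set topology) f.
        compact_space K \<and> Hausdorff_space K \<and> continuous_map K X f
          \<longrightarrow> closedin K {k \<in> topspace K. f k \<in> S})
      \<longrightarrow> closedin X S)"

definition cgwh_space :: "'a topology \<Rightarrow> bool" where
  "cgwh_space X \<longleftrightarrow> compactly_generated X \<and> weak_hausdorff X"


section \<open>Smooth manifolds and Lie groups\<close>

text \<open>
  The model space is \<^term>\<open>Euclidean_space n\<close>, whose points are the sequences vanishing from
  index \<open>n\<close> on. This allows dimension \<open>0\<close>, hence finite groups, which a model
  space of class \<^class>\<open>euclidean_space\<close> would exclude.

  \<open>C_k_on k n U f\<close>: on the open set \<open>U\<close>, all partial derivatives of \<open>f\<close> of order at most \<open>k\<close>
  exist and are continuous.
\<close>

fun C_k_on :: "nat \<Rightarrow> nat \<Rightarrow> (nat \<Rightarrow> real) set \<Rightarrow> ((nat \<Rightarrow> real) \<Rightarrow> real) \<Rightarrow> bool" where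
  "C_k_on 0 n U f \<longleftrightarrow>
    continuous_map (subtopology (Euclidean_space n) U) euclideanreal f"
| "C_k_on (Suc k) n U f \<longleftrightarrow>
    continuous_map (subtopology (Euclidean_space n) U) euclideanreal f \<and>
    (\<forall>i<n. \<exists>f'. C_k_on k n U f' \<and>
      (\<forall>x\<in>U. ((\<lambda>t. f (x(i := t))) has_real_derivative f' x) (at (x i))))"

definition smooth_between ::
    "nat \<Rightarrow> nat \<Rightarrow> (nat \<Rightarrow> real) set \<Rightarrow> ((nat \<Rightarrow> real) \<Rightarrow> (nat \<Rightarrow> real)) \<Rightarrow> bool" where
  "smooth_between m n U f \<longleftrightarrow> (\<forall>k. \<forall>j<n. C_k_on k m U (\<lambda>x. f x j))"

type_synonym 'a chart = "'a set \<times> ('a \<Rightarrow> nat \<Rightarrow> real)"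

definition is_chart :: "'a topology \<Rightarrow> nat \<Rightarrow> 'a chart \<Rightarrow> bool" where
  "is_chart T n = (\<lambda>(U, \<phi>).
    openin T U \<and> openin (Euclidean_space n) (\<phi> ` U) \<and>
    homeomorphic_map (subtopology T U) (subtopology (Euclidean_space n) (\<phi> ` U)) \<phi>)"

definition smooth_atlas :: "'a topology \<Rightarrow> nat \<Rightarrow> 'a chart set \<Rightarrow> bool" where
  "smooth_atlas T n A \<longleftrightarrow>
    (\<forall>c\<in>A. is_chart T n c) \<and>
    (\<Union>(U, \<phi>)\<in>A. U) = topspace T \<and>
    (\<forall>(U, \<phi>)\<in>A. \<forall>(V, \<psi>)\<in>A. smooth_between n n (\<phi> ` (U \<inter> V)) (\<psi> \<circ> inv_into U \<phi>))"

definition smooth_manifold :: "'a topology \<Rightarrow> nat \<Rightarrow> 'a chart set \<Rightarrow> bool" where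
  "smooth_manifold T n A \<longleftrightarrow>
    Hausdorff_space T \<and> second_countable T \<and> smooth_atlas T n A"

definition smooth_map ::
    "'a topology \<Rightarrow> nat \<Rightarrow> 'a chart set \<Rightarrow> 'b topology \<Rightarrow> nat \<Rightarrow> 'b chart set \<Rightarrow> ('a \<Rightarrow> 'b) \<Rightarrow> bool"
where
  "smooth_map S m A T n B f \<longleftrightarrow>
    continuous_map S T f \<and>
    (\<forall>(U, \<phi>)\<in>A. \<forall>(V, \<psi>)\<in>B.
      smooth_between m n (\<phi> ` {x \<in> U. f x \<in> V}) (\<psi> \<circ> f \<circ> inv_into U \<phi>))"

text \<open>The identification of \<open>\<real>\<^sup>m \<times> \<real>\<^sup>n\<close> with \<open>\<real>\<^bsup>m+n\<^esup>\<close> by concatenating coordinates.\<close>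

definition append_coords :: "nat \<Rightarrow> (nat \<Rightarrow> real) \<Rightarrow> (nat \<Rightarrow> real) \<Rightarrow> nat \<Rightarrow> real" where
  "append_coords m x y = (\<lambda>i. if i < m then x i else y (i - m))"

definition product_atlas :: "nat \<Rightarrow> 'a chart set \<Rightarrow> 'b chart set \<Rightarrow> ('a \<times> 'b) chart set" where
  "product_atlas m A B =
    {(U \<times> V, \<lambda>(x, y). append_coords m (\<phi> x) (\<psi> y)) | U \<phi> V \<psi>. (U, \<phi>) \<in> A \<and> (V, \<psi>) \<in> B}"

definition lie_group :: "('g, 'm) monoid_scheme \<Rightarrow> 'g topology \<Rightarrow> nat \<Rightarrow> 'g chart set \<Rightarrow> bool" where
  "lie_group G T n A \<longleftrightarrow>
    group G \<and> topspace T = carrier G \<and> smooth_manifold T n A \<and>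
    smooth_map (prod_topology T T) (n + n) (product_atlas n A A) T n A (\<lambda>(x, y). x \<otimes>\<^bsub>G\<^esub> y) \<and>
    smooth_map T n A T n A (\<lambda>x. inv\<^bsub>G\<^esub> x)"


section \<open>\<open>G\<close>-spaces\<close>

text \<open>
  For compact Hausdorff \<open>G\<close> and compactly generated \<open>X\<close> the ordinary product topology on
  \<open>G \<times> X\<close> is already compactly generated, so it is the product in compactly generated spaces.
\<close>

definition G_space ::
    "('g, 'm) monoid_scheme \<Rightarrow> 'g topology \<Rightarrow> 'x topology \<Rightarrow> ('g \<Rightarrow> 'x \<Rightarrow> 'x) \<Rightarrow> bool" where
  "G_space G T X act \<longleftrightarrow>
    cgwh_space X \<and> group_action G (topspace X) act \<and>
    continuous_map (prod_topology T X) X (\<lambda>(g, x). act g x)"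

definition G_map ::
    "('g, 'm) monoid_scheme \<Rightarrow> 'x topology \<Rightarrow> ('g \<Rightarrow> 'x \<Rightarrow> 'x) \<Rightarrow>
      'y topology \<Rightarrow> ('g \<Rightarrow> 'y \<Rightarrow> 'y) \<Rightarrow> ('x \<Rightarrow> 'y) \<Rightarrow> bool" where
  "G_map G X actX Y actY p \<longleftrightarrow>
    continuous_map X Y p \<and>
    (\<forall>g\<in>carrier G. \<forall>x\<in>topspace X. p (actX g x) = actY g (p x))"

definition G_invariant ::
    "('g, 'm) monoid_scheme \<Rightarrow> ('g \<Rightarrow> 'x \<Rightarrow> 'x) \<Rightarrow> 'x set \<Rightarrow> bool" where
  "G_invariant G act U \<longleftrightarrow> (\<forall>g\<in>carrier G. \<forall>x\<in>U. act g x \<in> U)"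

definition fixed_points :: "'g set \<Rightarrow> 'x topology \<Rightarrow> ('g \<Rightarrow> 'x \<Rightarrow> 'x) \<Rightarrow> 'x topology" where
  "fixed_points H X act = subtopology X {x \<in> topspace X. \<forall>h\<in>H. act h x = x}"


section \<open>Serre fibrations and \<open>\<C>\<close>-fibrations\<close>

definition disk :: "nat \<Rightarrow> (nat \<Rightarrow> real) topology" where
  "disk n = subtopology (Euclidean_space n) {x. (\<Sum>i<n. x i ^ 2) \<le> 1}"

definition serre_fibration :: "'x topology \<Rightarrow> 'y topology \<Rightarrow> ('x \<Rightarrow> 'y) \<Rightarrow> bool" where
  "serre_fibration X Y p \<longleftrightarrow>
    continuous_map X Y p \<and>
    (\<forall>n f h.
      continuous_map (disk n) X f \<and>
      continuous_map (prod_topology (disk n) (top_of_set {0..1::real})) Y h \<and>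
      (\<forall>x\<in>topspace (disk n). p (f x) = h (x, 0))
      \<longrightarrow> (\<exists>k. continuous_map (prod_topology (disk n) (top_of_set {0..1::real})) X k \<and>
              (\<forall>x\<in>topspace (disk n). k (x, 0) = f x) \<and>
              (\<forall>x\<in>topspace (disk n). \<forall>t\<in>{0..1}. p (k (x, t)) = h (x, t))))"

text \<open>
  The values of \<open>actX\<close> and \<open>actY\<close> outside the given spaces
  are irrelevant here, so the same action may be used for a \<open>G\<close>-space and its invariant
  subspaces.
\<close>

definition C_fibration ::
    "('g, 'm) monoid_scheme \<Rightarrow> 'g set set \<Rightarrow> 'x topology \<Rightarrow> ('g \<Rightarrow> 'x \<Rightarrow> 'x) \<Rightarrow>
      'y topology \<Rightarrow> ('g \<Rightarrow> 'y \<Rightarrow> 'y) \<Rightarrow> ('x \<Rightarrow> 'y) \<Rightarrow> bool" where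
  "C_fibration G \<C> X actX Y actY p \<longleftrightarrow>
    G_map G X actX Y actY p \<and>
    (\<forall>H\<in>\<C>. serre_fibration (fixed_points H X actX) (fixed_points H Y actY) p)"

definition closed_subgroups :: "('g, 'm) monoid_scheme \<Rightarrow> 'g topology \<Rightarrow> 'g set set" where
  "closed_subgroups G T = {H. subgroup H G \<and> closedin T H}"

definition closed_under_conjugacy :: "('g, 'm) monoid_scheme \<Rightarrow> 'g set set \<Rightarrow> bool" where
  "closed_under_conjugacy G \<C> \<longleftrightarrow>
    (\<forall>H\<in>\<C>. \<forall>g\<in>carrier G. (g <#\<^bsub>G\<^esub> H) #>\<^bsub>G\<^esub> (inv\<^bsub>G\<^esub> g) \<in> \<C>)"

end

theory Submission
  imports Defs
begin

text \<open>
  Taking \<open>H\<close>-fixed points turns the cover of \<open>Y\<close> into an open cover of \<open>Y\<^sup>H\<close>, and the fixed points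
  of \<open>p\<^sup>-\<^sup>1(U\<^sub>i)\<close> are the part of \<open>X\<^sup>H\<close> over it. So the theorem reduces, one subgroup
  at a time, to the non-equivariant fact that being a Serre fibration is local on the base
  (\<open>serre_fibration_local\<close>).

  The usual proof of that fact subdivides \<open>D\<^sup>n \<times> [0,1]\<close> and lifts cell by cell, which
  needs lifting relative to the boundary of a cell. The proof below needs no relative lifting. A
  homotopy \<open>h : K \<times> [0,1] \<rightarrow> Y\<close> is lifted over a region \<open>{(x, t). t \<le> \<tau> x}\<close> below the graph of
  a continuous \<open>\<tau> : K \<rightarrow> [0,1]\<close>, and \<open>\<tau>\<close> is raised from \<open>0\<close> to \<open>1\<close>. If \<open>\<tau>\<close> is raised only over
  a closed set \<open>Q\<close> on which the homotopy stays in one member \<open>V\<close> of the cover, the missing part of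
  the lift is an ordinary homotopy on \<open>Q\<close>, started at the old lift on the graph of \<open>\<tau>\<close>; it
  is lifted by the fibration over \<open>V\<close>, and the two lifts agree on the graph
  (\<open>partial_lift_extend\<close>). Bump functions and compactness of \<open>K\<close> then raise \<open>\<tau>\<close> across a thin slab
  \<open>K \<times> [a,b]\<close> (\<open>partial_lift_slab\<close>), and compactness of \<open>[0,1]\<close> splits the homotopy into
  finitely many thin slabs (\<open>homotopy_lifting_local\<close>).

  All that is asked of the compact Hausdorff space \<open>K\<close> is that each point has arbitrarily small
  closed neighbourhoods \<open>Q\<close> with the homotopy lifting property for the given fibrations. Coordinate boxes in \<open>\<real>\<^sup>n\<close> have this property, since
  their small neighbourhoods contain smaller boxes and every nonempty box is, up to scaling, a retract of a
  disk by clamping coordinates. Conversely the disk is a retract of a cube, so lifting against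
  cubes gives lifting against disks.
\<close>


section \<open>Homotopy lifting against a single space\<close>

definition homotopy_lifting ::
    "'k topology \<Rightarrow> 'x topology \<Rightarrow> 'y topology \<Rightarrow> ('x \<Rightarrow> 'y) \<Rightarrow> bool" where
  "homotopy_lifting K X Y p \<longleftrightarrow>
    (\<forall>f h.
      continuous_map K X f \<and>
      continuous_map (prod_topology K (top_of_set {0..1::real})) Y h \<and>
      (\<forall>x\<in>topspace K. p (f x) = h (x, 0))
      \<longrightarrow> (\<exists>k. continuous_map (prod_topology K (top_of_set {0..1::real})) X k \<and>
              (\<forall>x\<in>topspace K. k (x, 0) = f x) \<and>
              (\<forall>x\<in>topspace K. \<forall>t\<in>{0..1}. p (k (x, t)) = h (x, t))))"

lemma serre_fibration_iff:
  "serre_fibration X Y p \<longleftrightarrow>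
    continuous_map X Y p \<and> (\<forall>n. homotopy_lifting (disk n) X Y p)"
  by (simp add: serre_fibration_def homotopy_lifting_def)

text \<open>
  A lifting problem on \<open>K\<close> is pulled back to \<open>L\<close> along \<open>r\<close>, solved there, and restricted along \<open>s\<close>.
\<close>

lemma homotopy_lifting_retract:
  assumes L: "homotopy_lifting L X Y p"
    and s: "continuous_map K L s" and r: "continuous_map L K r"
    and rs: "\<And>x. x \<in> topspace K \<Longrightarrow> r (s x) = x"
  shows "homotopy_lifting K X Y p"
  unfolding homotopy_lifting_def
proof (intro allI impI, elim conjE)
  let ?I = "top_of_set {0..1::real}"
  fix f h
  assume f: "continuous_map K X f" and h: "continuous_map (prod_topology K ?I) Y h"
    and fh: "\<forall>x\<in>topspace K. p (f x) = h (x, 0)"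
  have rL: "r x \<in> topspace K" if "x \<in> topspace L" for x
    using r that by (auto simp: continuous_map_def)
  have sK: "s x \<in> topspace L" if "x \<in> topspace K" for x
    using s that by (auto simp: continuous_map_def)
  have "continuous_map (prod_topology L ?I) (prod_topology K ?I) (\<lambda>z. (r (fst z), snd z))"
    by (intro continuous_map_pairedI continuous_map_snd
        continuous_map_compose[OF continuous_map_fst r, unfolded o_def])
  then have h': "continuous_map (prod_topology L ?I) Y (\<lambda>z. h (r (fst z), snd z))"
    using continuous_map_compose[OF _ h] by (fastforce simp: o_def)
  have f': "continuous_map L X (\<lambda>x. f (r x))"
    using continuous_map_compose[OF r f] by (simp add: o_def)
  obtain k where k: "continuous_map (prod_topology L ?I) X k"
    and k0: "\<And>x. x \<in> topspace L \<Longrightarrow> k (x, 0) = f (r x)"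
    and kp: "\<And>x t. x \<in> topspace L \<Longrightarrow> t \<in> {0..1} \<Longrightarrow> p (k (x, t)) = h (r x, t)"
    using L[unfolded homotopy_lifting_def, rule_format, of "\<lambda>x. f (r x)" "\<lambda>z. h (r (fst z), snd z)"]
      f' h' fh rL by auto
  have "continuous_map (prod_topology K ?I) (prod_topology L ?I) (\<lambda>z. (s (fst z), snd z))"
    by (intro continuous_map_pairedI continuous_map_snd
        continuous_map_compose[OF continuous_map_fst s, unfolded o_def])
  then have "continuous_map (prod_topology K ?I) X (\<lambda>z. k (s (fst z), snd z))"
    using continuous_map_compose[OF _ k] by (fastforce simp: o_def)
  then show "\<exists>k. continuous_map (prod_topology K ?I) X k \<and>
      (\<forall>x\<in>topspace K. k (x, 0) = f x) \<and>
      (\<forall>x\<in>topspace K. \<forall>t\<in>{0..1}. p (k (x, t)) = h (x, t))"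
    using k0 kp sK rs by (intro exI[of _ "\<lambda>z. k (s (fst z), snd z)"]) auto
qed


section \<open>Boxes and disks\<close>

text \<open>
  Boxes are taken in the space of all real sequences. A box with \<open>a i = b i = 0\<close> for \<open>i \<ge> n\<close> is a box
  in \<open>\<real>\<^sup>n\<close>.
\<close>

definition real_box :: "(nat \<Rightarrow> real) \<Rightarrow> (nat \<Rightarrow> real) \<Rightarrow> (nat \<Rightarrow> real) topology" where
  "real_box a b = subtopology (powertop_real UNIV) {x. \<forall>i. a i \<le> x i \<and> x i \<le> b i}"

lemma box_PiE: "{x. \<forall>i. a i \<le> x i \<and> x i \<le> b i} = Pi\<^sub>E UNIV (\<lambda>i. {a i..b i :: real})"
  by (auto simp: PiE_iff)

lemma topspace_real_box: "topspace (real_box a b) = {x. \<forall>i. a i \<le> x i \<and> x i \<le> b i}"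
  by (simp add: real_box_def)

lemma compact_space_real_box: "compact_space (real_box a b)"
  unfolding real_box_def box_PiE compact_space_subtopology
  by (simp add: compact_space_subtopology compactin_PiE)

lemma Hausdorff_space_real_box: "Hausdorff_space (real_box a b)"
  unfolding real_box_def
  by (simp add: Hausdorff_space_subtopology Hausdorff_space_product_topology)

lemma continuous_map_real_box_proj: "continuous_map (real_box a b) euclideanreal (\<lambda>x. x i)"
  unfolding real_box_def by (intro continuous_intros) auto

lemma disk_eq:
  "disk n = subtopology (powertop_real UNIV) {x. (\<forall>i\<ge>n. x i = 0) \<and> (\<Sum>i<n. x i ^ 2) \<le> 1}"
  by (simp add: disk_def Euclidean_space_def subtopology_subtopology Collect_conj_eq)

text \<open>
  The box shrunk by a large factor \<open>c\<close> lies in the unit disk; scaling back by \<open>c\<close> and clamping each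
  coordinate to the box is a retraction.
\<close>

lemma homotopy_lifting_real_box:
  assumes p: "homotopy_lifting (disk n) X Y p"
    and ab: "\<And>i. i < n \<Longrightarrow> a i \<le> b i" and z: "\<And>i. n \<le> i \<Longrightarrow> a i = 0 \<and> b i = 0"
  shows "homotopy_lifting (real_box a b) X Y p"
proof -
  define M where "M i = \<bar>a i\<bar> + \<bar>b i\<bar>" for i
  \<comment> \<open>As \<open>c \<ge> 1\<close>, the square sum of any point of the box is at most \<open>c \<le> c\<^sup>2\<close>.\<close>
  define c where "c = 1 + (\<Sum>i<n. (M i)\<^sup>2)"
  have c1: "1 \<le> c" by (simp add: c_def sum_nonneg)
  show ?thesis
  proof (rule homotopy_lifting_retract[OF p])
    show "continuous_map (real_box a b) (disk n) (\<lambda>x i. x i / c)"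
      unfolding disk_eq continuous_map_in_subtopology
    proof
      show "continuous_map (real_box a b) (powertop_real UNIV) (\<lambda>x i. x i / c)"
        unfolding continuous_map_componentwise_UNIV
        using c1 by (auto intro!: continuous_map_real_divide continuous_map_real_box_proj)
      show "(\<lambda>x i. x i / c) \<in> topspace (real_box a b) \<rightarrow>
          {x. (\<forall>i\<ge>n. x i = 0) \<and> (\<Sum>i<n. x i ^ 2) \<le> 1}"
      proof (clarsimp simp: topspace_real_box, intro conjI allI impI)
        fix x :: "nat \<Rightarrow> real" assume x: "\<forall>i. a i \<le> x i \<and> x i \<le> b i"
        show "x i = 0 \<or> c = 0" if "n \<le> i" for i
          using x z[OF that] by (metis order_antisym)
        have "\<bar>x i\<bar> \<le> M i" for i
          using x[rule_format, of i] unfolding M_def by linarith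
        then have "(\<Sum>i<n. (x i)\<^sup>2) \<le> (\<Sum>i<n. (M i)\<^sup>2)"
          by (intro sum_mono) (metis abs_ge_zero power2_abs power_mono)
        also have "\<dots> \<le> c" by (simp add: c_def)
        also have "\<dots> \<le> c\<^sup>2" using c1 by (simp add: power2_eq_square)
        finally show "(\<Sum>i<n. (x i / c)\<^sup>2) \<le> 1"
          using c1 by (simp add: power_divide flip: sum_divide_distrib)
      qed
    qed
    show "continuous_map (disk n) (real_box a b) (\<lambda>y i. max (a i) (min (b i) (c * y i)))"
      unfolding real_box_def continuous_map_in_subtopology
    proof
      show "continuous_map (disk n) (powertop_real UNIV) (\<lambda>y i. max (a i) (min (b i) (c * y i)))"
        unfolding disk_eq continuous_map_componentwise_UNIV
        by (intro allI continuous_intros continuous_map_const[THEN iffD2]) auto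
      show "(\<lambda>y i. max (a i) (min (b i) (c * y i))) \<in> topspace (disk n) \<rightarrow>
          {x. \<forall>i. a i \<le> x i \<and> x i \<le> b i}"
        using ab z by (auto simp: not_less) (metis not_less order_refl)
    qed
    show "(\<lambda>i. max (a i) (min (b i) (c * (x i / c)))) = x" if "x \<in> topspace (real_box a b)" for x
      using that c1 by (simp add: topspace_real_box min_absorb2 max_absorb2)
  qed
qed

text \<open>
  The disk sits in the cube with sides \<open>[-1,1]\<close>, and radial projection \<open>x / max 1 \<bar>x\<bar>\<close> retracts the
  cube onto it.
\<close>

lemma homotopy_lifting_disk:
  fixes n :: nat
  defines "e \<equiv> \<lambda>i. if i < n then 1 else 0 :: real"
  assumes p: "homotopy_lifting (real_box (\<lambda>i. - e i) e) X Y p"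
  shows "homotopy_lifting (disk n) X Y p"
proof (rule homotopy_lifting_retract[OF p])
  have le: "\<bar>x i\<bar> \<le> e i" if "x \<in> topspace (disk n)" for x i
  proof (cases "i < n")
    case True
    have "(x i)\<^sup>2 \<le> (\<Sum>i<n. x i ^ 2)" using True by (intro member_le_sum) auto
    also have "\<dots> \<le> 1" using that by (simp add: disk_eq)
    finally show ?thesis using True by (simp add: e_def abs_square_le_1)
  qed (use that in \<open>auto simp: disk_eq e_def\<close>)
  show "continuous_map (disk n) (real_box (\<lambda>i. - e i) e) (\<lambda>x. x)"
    unfolding real_box_def continuous_map_in_subtopology
  proof
    show "continuous_map (disk n) (powertop_real UNIV) (\<lambda>x. x)"
      unfolding disk_eq continuous_map_componentwise_UNIV by (intro allI continuous_intros) auto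
    show "(\<lambda>x. x) \<in> topspace (disk n) \<rightarrow> {x. \<forall>i. - e i \<le> x i \<and> x i \<le> e i}"
      using le by (intro Pi_I CollectI allI) (simp add: abs_le_iff minus_le_iff)
  qed
  define m where "m x = max 1 (sqrt (\<Sum>i<n. (x i)\<^sup>2))" for x :: "nat \<Rightarrow> real"
  have m1: "1 \<le> m x" for x by (simp add: m_def)
  have mx: "(\<Sum>i<n. (x i)\<^sup>2) \<le> (m x)\<^sup>2" for x
    using m1[of x] by (simp add: m_def sqrt_le_D)
  show "continuous_map (real_box (\<lambda>i. - e i) e) (disk n) (\<lambda>x i. x i / m x)"
    unfolding disk_eq continuous_map_in_subtopology
  proof
    have "continuous_map (real_box (\<lambda>i. - e i) e) euclideanreal (\<lambda>x. \<Sum>i<n. (x i)\<^sup>2)"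
      by (intro continuous_intros continuous_map_real_box_proj) auto
    then have "continuous_map (real_box (\<lambda>i. - e i) e) euclideanreal (\<lambda>x. sqrt (\<Sum>i<n. (x i)\<^sup>2))"
      by (rule continuous_map_compose[where X' = euclideanreal and g = sqrt, unfolded o_def])
        (simp add: continuous_on_real_sqrt)
    then have "continuous_map (real_box (\<lambda>i. - e i) e) euclideanreal m"
      unfolding m_def by (intro continuous_map_real_max) auto
    then show "continuous_map (real_box (\<lambda>i. - e i) e) (powertop_real UNIV) (\<lambda>x i. x i / m x)"
      unfolding continuous_map_componentwise_UNIV
      using m1 by (auto intro!: continuous_map_real_divide continuous_map_real_box_proj)
        (metis not_one_le_zero)
    show "(\<lambda>x i. x i / m x) \<in> topspace (real_box (\<lambda>i. - e i) e) \<rightarrow>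
        {x. (\<forall>i\<ge>n. x i = 0) \<and> (\<Sum>i<n. x i ^ 2) \<le> 1}"
    proof (clarsimp simp: topspace_real_box, intro conjI allI impI)
      fix x assume x: "\<forall>i. - e i \<le> x i \<and> x i \<le> e i"
      show "x i = 0 \<or> m x = 0" if "n \<le> i" for i
        using x[rule_format, of i] that by (simp add: e_def)
      show "(\<Sum>i<n. (x i / m x)\<^sup>2) \<le> 1"
        using mx[of x] m1[of x] by (simp add: power_divide flip: sum_divide_distrib)
    qed
  qed
  show "(\<lambda>i. x i / m x) = x" if "x \<in> topspace (disk n)" for x
  proof -
    have "m x = 1" using that by (simp add: m_def disk_eq)
    then show ?thesis by simp
  qed
qed

text \<open>
  A basic open set around \<open>x\<close> is a product of open sets of reals, so it contains a product of
  intervals around the coordinates of \<open>x\<close>. The coordinates from \<open>n\<close> on are constantly \<open>0\<close> on the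
  box; hence finitely many open conditions, those with \<open>i < n\<close>, cut out an open set inside this
  product.
\<close>

lemma neighbourhood_base_of_sub_boxes:
  assumes z: "\<And>i. n \<le> i \<Longrightarrow> a i = 0 \<and> b i = 0"
  shows "neighbourhood_base_of
    (\<lambda>Q. closedin (real_box a b) Q \<and>
      (\<exists>c d. (\<forall>i<n. c i \<le> d i) \<and> (\<forall>i\<ge>n. c i = 0 \<and> d i = 0) \<and>
        subtopology (real_box a b) Q = real_box c d)) (real_box a b)"
  unfolding neighbourhood_base_of
proof (intro allI impI, elim conjE)
  fix W x assume W: "openin (real_box a b) W" and x: "x \<in> W"
  obtain S where S: "openin (powertop_real UNIV) S" and WS: "W = S \<inter> topspace (real_box a b)"
    using W by (auto simp: real_box_def openin_subtopology)
  obtain V where V: "\<And>i. open (V i)" "x \<in> Pi\<^sub>E UNIV V" "Pi\<^sub>E UNIV V \<subseteq> S"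
    using S x unfolding WS openin_product_topology_alt by fastforce
  have "\<exists>e>0. cball (x i) e \<subseteq> V i" for i
    using V by (auto simp: PiE_iff open_contains_cball)
  then obtain e where e: "\<And>i. 0 < e i" "\<And>i. cball (x i) (e i) \<subseteq> V i"
    by metis
  define c where "c i = max (a i) (x i - e i)" for i
  define d where "d i = min (b i) (x i + e i)" for i
  define Q where "Q = {y. \<forall>i. c i \<le> y i \<and> y i \<le> d i}"
  define N where "N = {y \<in> topspace (real_box a b). \<forall>i<n. y i \<in> {x i - e i<..<x i + e i}}"
  have xb: "a i \<le> x i" "x i \<le> b i" for i
    using x by (auto simp: WS topspace_real_box)
  have Qsub: "Q \<subseteq> {x. \<forall>i. a i \<le> x i \<and> x i \<le> b i}"
    by (auto simp: Q_def c_def d_def)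
  have "openin (real_box a b) N"
  proof -
    have *: "openin (real_box a b) {y \<in> topspace (real_box a b). y i \<in> {x i - e i<..<x i + e i}}" for i
      by (rule openin_continuous_map_preimage[OF continuous_map_real_box_proj]) simp
    have "openin (real_box a b) (topspace (real_box a b) \<inter>
      (\<Inter>i<n. {y \<in> topspace (real_box a b). y i \<in> {x i - e i<..<x i + e i}}))"
      by (intro openin_Int_Inter finite_imageI)
        (use * in blast)+
    also have "topspace (real_box a b) \<inter>
      (\<Inter>i<n. {y \<in> topspace (real_box a b). y i \<in> {x i - e i<..<x i + e i}}) = N"
      by (auto simp: N_def)
    finally show ?thesis .
  qed
  moreover have "closedin (real_box a b) Q"
  proof -
    have "closedin (powertop_real UNIV) Q"
      unfolding Q_def box_PiE by (simp add: closedin_product_topology)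
    then show ?thesis
      unfolding real_box_def using Qsub by (simp add: closedin_subset_topspace)
  qed
  moreover have "subtopology (real_box a b) Q = real_box c d"
    using Qsub by (simp add: real_box_def subtopology_subtopology Int_absorb1 flip: Q_def)
  moreover have "c i \<le> d i" for i
    using xb[of i] e(1)[of i] by (auto simp: c_def d_def)
  moreover have "c i = 0 \<and> d i = 0" if "n \<le> i" for i
    using z[OF that] xb[of i] e(1)[of i] by (auto simp: c_def d_def)
  moreover have "x \<in> N"
    using x e(1) by (auto simp: N_def WS)
  moreover have "N \<subseteq> Q"
  proof
    fix y assume y: "y \<in> N"
    have "c i \<le> y i \<and> y i \<le> d i" for i
    proof (cases "i < n")
      case True
      then have "x i - e i < y i" "y i < x i + e i" "a i \<le> y i" "y i \<le> b i"
        using y by (auto simp: N_def topspace_real_box)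
      then show ?thesis by (simp add: c_def d_def)
    next
      case False
      moreover have "a i \<le> y i" "y i \<le> b i"
        using y by (auto simp: N_def topspace_real_box)
      ultimately show ?thesis
        using z[of i] xb[of i] e(1)[of i] by (auto simp: c_def d_def)
    qed
    then show "y \<in> Q" by (simp add: Q_def)
  qed
  moreover have "Q \<subseteq> W"
  proof
    fix y assume y: "y \<in> Q"
    have "y i \<in> V i" for i
    proof -
      have "y i \<in> cball (x i) (e i)"
        using y by (auto simp: Q_def c_def d_def dist_real_def abs_le_iff algebra_simps)
      then show ?thesis using e(2) by blast
    qed
    then have "y \<in> S" using V(3) by (auto simp: PiE_iff)
    then show "y \<in> W" using y Qsub by (auto simp: WS topspace_real_box)
  qed
  ultimately show "\<exists>N Q. openin (real_box a b) N \<and>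
      (closedin (real_box a b) Q \<and>
        (\<exists>c d. (\<forall>i<n. c i \<le> d i) \<and> (\<forall>i\<ge>n. c i = 0 \<and> d i = 0) \<and>
          subtopology (real_box a b) Q = real_box c d)) \<and> x \<in> N \<and> N \<subseteq> Q \<and> Q \<subseteq> W"
    by blast
qed


section \<open>Lifts below a graph\<close>

definition under_graph :: "'k topology \<Rightarrow> ('k \<Rightarrow> real) \<Rightarrow> ('k \<times> real) topology" where
  "under_graph K \<tau> =
    subtopology (prod_topology K euclideanreal) {z. 0 \<le> snd z \<and> snd z \<le> \<tau> (fst z)}"

lemma topspace_under_graph:
  "topspace (under_graph K \<tau>) = {(x, t). x \<in> topspace K \<and> 0 \<le> t \<and> t \<le> \<tau> x}"
  by (auto simp: under_graph_def)

lemma continuous_map_under_graph_fst: "continuous_map (under_graph K \<tau>) K fst"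
  unfolding under_graph_def by (intro continuous_map_from_subtopology continuous_map_fst)

lemma continuous_map_under_graph_snd: "continuous_map (under_graph K \<tau>) euclideanreal snd"
  unfolding under_graph_def by (intro continuous_map_from_subtopology continuous_map_snd)

text \<open>
  The homotopy \<open>h\<close> is taken on \<open>K \<times> \<real>\<close>, so that time can be shifted without leaving its domain.
\<close>

definition partial_lift ::
    "'k topology \<Rightarrow> 'x topology \<Rightarrow> ('x \<Rightarrow> 'y) \<Rightarrow> ('k \<Rightarrow> 'x) \<Rightarrow> ('k \<times> real \<Rightarrow> 'y) \<Rightarrow>
      ('k \<Rightarrow> real) \<Rightarrow> ('k \<times> real \<Rightarrow> 'x) \<Rightarrow> bool" where
  "partial_lift K X p f h \<tau> k \<longleftrightarrow>
    continuous_map (under_graph K \<tau>) X k \<and>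
    (\<forall>x\<in>topspace K. k (x, 0) = f x) \<and>
    (\<forall>x\<in>topspace K. \<forall>t. 0 \<le> t \<and> t \<le> \<tau> x \<longrightarrow> p (k (x, t)) = h (x, t))"

lemma partial_lift_cong:
  assumes "\<And>x. x \<in> topspace K \<Longrightarrow> \<tau> x = \<tau>' x" "partial_lift K X p f h \<tau> k"
  shows "partial_lift K X p f h \<tau>' k"
proof -
  let ?P = "prod_topology K euclideanreal"
  have "topspace ?P \<inter> {z. 0 \<le> snd z \<and> snd z \<le> \<tau> (fst z)} =
      topspace ?P \<inter> {z. 0 \<le> snd z \<and> snd z \<le> \<tau>' (fst z)}"
    using assms(1) by auto
  then have "under_graph K \<tau> = under_graph K \<tau>'"
    unfolding under_graph_def
    by (subst (1 2) subtopology_restrict[symmetric]) simp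
  then show ?thesis using assms by (auto simp: partial_lift_def)
qed

text \<open>
  Over \<open>Q\<close>, the strip between the graphs of \<open>\<tau>\<close> and \<open>\<tau>'\<close> is straightened by measuring time from
  \<open>\<tau> x\<close> on. This makes the remaining lifting problem one with initial value \<open>k (x, \<tau> x)\<close> and
  homotopy \<open>s \<mapsto> h (x, \<tau> x + s)\<close>, all inside \<open>V\<close>. Away from \<open>Q\<close> the strip is empty, so the old
  region and the strip over \<open>Q\<close> are two closed sets covering the new region.
\<close>

lemma partial_lift_extend:
  fixes K :: "'k topology" and a b :: real
  assumes lift: "partial_lift K X p f h \<tau> k"
    and h: "continuous_map (prod_topology K euclideanreal) Y h"
    and \<tau>: "continuous_map K euclideanreal \<tau>" and \<tau>': "continuous_map K euclideanreal \<tau>'"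
    and ab: "0 \<le> a" "b \<le> 1"
    and bounds: "\<And>x. x \<in> topspace K \<Longrightarrow> a \<le> \<tau> x \<and> \<tau> x \<le> \<tau>' x \<and> \<tau>' x \<le> b"
    and Q: "closedin K Q" and off: "\<And>x. x \<in> topspace K - Q \<Longrightarrow> \<tau>' x = \<tau> x"
    and hV: "\<And>x t. x \<in> Q \<Longrightarrow> a \<le> t \<Longrightarrow> t \<le> b \<Longrightarrow> h (x, t) \<in> V"
    and p: "homotopy_lifting (subtopology K Q)
      (subtopology X {x \<in> topspace X. p x \<in> V}) (subtopology Y V) p"
  shows "\<exists>k'. partial_lift K X p f h \<tau>' k'"
proof -
  let ?I = "top_of_set {0..1::real}" and ?KQ = "subtopology K Q"
  have QK: "Q \<subseteq> topspace K" using Q by (rule closedin_subset)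
  have k: "continuous_map (under_graph K \<tau>) X k"
    and k0: "\<And>x. x \<in> topspace K \<Longrightarrow> k (x, 0) = f x"
    and pk: "\<And>x t. x \<in> topspace K \<Longrightarrow> 0 \<le> t \<Longrightarrow> t \<le> \<tau> x \<Longrightarrow> p (k (x, t)) = h (x, t)"
    using lift by (auto simp: partial_lift_def)
  have \<tau>Q: "continuous_map ?KQ euclideanreal \<tau>"
    using \<tau> by (rule continuous_map_from_subtopology)
  have idQ: "continuous_map ?KQ K (\<lambda>x. x)"
    using continuous_map_from_subtopology[OF continuous_map_id, of K Q] by (simp add: id_def)
  have \<tau>0: "0 \<le> \<tau> x" if "x \<in> topspace K" for x
    using bounds[OF that] ab by linarith
  have kX: "k (x, \<tau> x) \<in> topspace X" if "x \<in> topspace K" for x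
    using continuous_map_funspace[OF k] bounds[OF that] ab that
    by (auto simp: topspace_under_graph Pi_iff)

  have "continuous_map ?KQ (under_graph K \<tau>) (\<lambda>x. (x, \<tau> x))"
    unfolding under_graph_def
    by (intro continuous_map_into_subtopology continuous_map_pairedI \<tau>Q idQ)
      (simp add: Pi_iff \<tau>0)
  then have "continuous_map ?KQ X (\<lambda>x. k (x, \<tau> x))"
    by (rule continuous_map_compose[OF _ k, unfolded o_def])
  moreover have "p (k (x, \<tau> x)) \<in> V" if "x \<in> Q" for x
    using pk[of x "\<tau> x"] bounds[of x] hV[of x "\<tau> x"] ab QK that by force
  ultimately have f': "continuous_map ?KQ (subtopology X {x \<in> topspace X. p x \<in> V}) (\<lambda>x. k (x, \<tau> x))"
    using kX by (intro continuous_map_into_subtopology) auto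
  have snd: "continuous_map (prod_topology ?KQ ?I) euclideanreal snd"
    using continuous_map_snd by (rule continuous_map_into_fulltopology)
  have fst: "continuous_map (prod_topology ?KQ ?I) ?KQ fst"
    by (rule continuous_map_fst)
  \<comment> \<open>The homotopy stops at time \<open>b\<close>, because \<open>\<tau> x + s\<close> may leave the slab where \<open>h\<close> stays in \<open>V\<close>.\<close>
  have "continuous_map (prod_topology ?KQ ?I) (prod_topology K euclideanreal)
      (\<lambda>z. (fst z, min b (\<tau> (fst z) + snd z)))"
    by (intro continuous_map_pairedI continuous_map_real_min continuous_map_add snd
        continuous_map_into_fulltopology[OF fst] continuous_map_compose[OF fst \<tau>Q, unfolded o_def])
      simp
  then have "continuous_map (prod_topology ?KQ ?I) Y (\<lambda>z. h (fst z, min b (\<tau> (fst z) + snd z)))"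
    by (rule continuous_map_compose[OF _ h, unfolded o_def])
  then have h': "continuous_map (prod_topology ?KQ ?I) (subtopology Y V)
      (\<lambda>z. h (fst z, min b (\<tau> (fst z) + snd z)))"
  proof (rule continuous_map_into_subtopology)
    show "(\<lambda>z. h (fst z, min b (\<tau> (fst z) + snd z))) \<in> topspace (prod_topology ?KQ ?I) \<rightarrow> V"
    proof clarsimp
      fix x and t :: real assume "x \<in> topspace K" "x \<in> Q" "0 \<le> t"
      then show "h (x, min b (\<tau> x + t)) \<in> V"
        using bounds[of x] by (intro hV) auto
    qed
  qed
  have f'h': "p (k (x, \<tau> x)) = h (x, min b (\<tau> x + 0))" if "x \<in> topspace ?KQ" for x
    using bounds[of x] pk[of x "\<tau> x"] ab that by (simp add: min_absorb2)
  obtain l where l: "continuous_map (prod_topology ?KQ ?I) (subtopology X {x \<in> topspace X. p x \<in> V}) l"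
    and l0: "\<And>x. x \<in> Q \<Longrightarrow> l (x, 0) = k (x, \<tau> x)"
    and pl: "\<And>x t. x \<in> Q \<Longrightarrow> t \<in> {0..1} \<Longrightarrow> p (l (x, t)) = h (x, min b (\<tau> x + t))"
    using p[unfolded homotopy_lifting_def, rule_format,
        of "\<lambda>x. k (x, \<tau> x)" "\<lambda>z. h (fst z, min b (\<tau> (fst z) + snd z))"] f' h' f'h' QK
    by (auto simp: Int_absorb1)

  define k' where "k' z = (if snd z \<le> \<tau> (fst z) then k z else l (fst z, snd z - \<tau> (fst z)))" for z
  define old where "old = {z \<in> topspace (under_graph K \<tau>'). snd z \<le> \<tau> (fst z)}"
  define new where "new = {z \<in> topspace (under_graph K \<tau>'). fst z \<in> Q \<and> \<tau> (fst z) \<le> snd z}"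
  have \<tau>fst: "continuous_map (under_graph K \<tau>') euclideanreal (\<lambda>z. \<tau> (fst z))"
    using continuous_map_compose[OF continuous_map_under_graph_fst \<tau>] by (simp add: o_def)
  have diff: "continuous_map (under_graph K \<tau>') euclideanreal (\<lambda>z. snd z - \<tau> (fst z))"
    by (intro continuous_map_diff continuous_map_under_graph_snd \<tau>fst)
  have old_closed: "closedin (under_graph K \<tau>') old"
    using closedin_continuous_map_preimage[OF diff, of "{..0}"] by (simp add: old_def)
  have new_closed: "closedin (under_graph K \<tau>') new"
  proof -
    have "closedin (under_graph K \<tau>')
      ({z \<in> topspace (under_graph K \<tau>'). fst z \<in> Q} \<inter>
       {z \<in> topspace (under_graph K \<tau>'). snd z - \<tau> (fst z) \<in> {0..}})"
      by (intro closedin_Int closedin_continuous_map_preimage[OF diff]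
          closedin_continuous_map_preimage[OF continuous_map_under_graph_fst Q]) simp
    also have "{z \<in> topspace (under_graph K \<tau>'). fst z \<in> Q} \<inter>
       {z \<in> topspace (under_graph K \<tau>'). snd z - \<tau> (fst z) \<in> {0..}} = new"
      by (auto simp: new_def)
    finally show ?thesis .
  qed
  have old_cont: "continuous_map (subtopology (under_graph K \<tau>') old) X k"
  proof -
    have "old \<subseteq> {z. 0 \<le> snd z \<and> snd z \<le> \<tau> (fst z)}" "old \<subseteq> {z. 0 \<le> snd z \<and> snd z \<le> \<tau>' (fst z)}"
      by (auto simp: old_def topspace_under_graph)
    then have "subtopology (under_graph K \<tau>') old = subtopology (under_graph K \<tau>) old"
      by (simp add: under_graph_def subtopology_subtopology Int_absorb1)
    then show ?thesis using k by (simp add: continuous_map_from_subtopology)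
  qed
  have new_cont: "continuous_map (subtopology (under_graph K \<tau>') new) X (\<lambda>z. l (fst z, snd z - \<tau> (fst z)))"
  proof -
    have fstQ: "continuous_map (subtopology (under_graph K \<tau>') new) ?KQ fst"
      by (intro continuous_map_into_subtopology
          continuous_map_from_subtopology[OF continuous_map_under_graph_fst]) (auto simp: new_def)
    have "snd z - \<tau> (fst z) \<in> {0..1}" if "z \<in> new" for z
      using that bounds[of "fst z"] ab by (auto simp: new_def topspace_under_graph)
    then have "continuous_map (subtopology (under_graph K \<tau>') new) (prod_topology ?KQ ?I)
        (\<lambda>z. (fst z, snd z - \<tau> (fst z)))"
      by (intro continuous_map_pairedI fstQ continuous_map_into_subtopology
          continuous_map_from_subtopology[OF diff]) auto
    then show ?thesis
      by (rule continuous_map_compose[OF _ continuous_map_into_fulltopology[OF l], unfolded o_def])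
  qed
  have "continuous_map (under_graph K \<tau>') X k'"
  proof (rule pasting_lemma_closed[where I = "{True, False}" and T = "\<lambda>c. if c then old else new"
        and f = "\<lambda>c. if c then k else (\<lambda>z. l (fst z, snd z - \<tau> (fst z)))"])
    have agree: "k z = l (fst z, snd z - \<tau> (fst z))" if "z \<in> old" "z \<in> new" for z
    proof -
      have "snd z = \<tau> (fst z)" using that by (auto simp: old_def new_def)
      then show ?thesis using l0[of "fst z"] that by (cases z) (auto simp: new_def)
    qed
    show "(if i then k else (\<lambda>z. l (fst z, snd z - \<tau> (fst z)))) z =
        (if j then k else (\<lambda>z. l (fst z, snd z - \<tau> (fst z)))) z"
      if "z \<in> topspace (under_graph K \<tau>') \<inter> (if i then old else new) \<inter> (if j then old else new)"
      for i j z
      using agree[of z] that by (auto split: if_splits)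
    show "\<exists>j. j \<in> {True, False} \<and> z \<in> (if j then old else new) \<and>
        k' z = (if j then k else (\<lambda>z. l (fst z, snd z - \<tau> (fst z)))) z"
      if z: "z \<in> topspace (under_graph K \<tau>')" for z
    proof (cases "snd z \<le> \<tau> (fst z)")
      case True
      then show ?thesis using z by (intro exI[of _ True]) (simp add: old_def k'_def)
    next
      case False
      then have "fst z \<in> Q" using off[of "fst z"] z by (fastforce simp: topspace_under_graph)
      then show ?thesis using z False by (intro exI[of _ False]) (simp add: new_def k'_def)
    qed
  qed (use old_closed new_closed old_cont new_cont in \<open>auto split: if_splits\<close>)
  moreover have "k' (x, 0) = f x" if "x \<in> topspace K" for x
    using bounds[OF that] ab k0[OF that] by (simp add: k'_def)
  moreover have "p (k' (x, t)) = h (x, t)" if x: "x \<in> topspace K" and t: "0 \<le> t" "t \<le> \<tau>' x" for x t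
  proof (cases "t \<le> \<tau> x")
    case True
    then show ?thesis using pk[OF x t(1)] by (simp add: k'_def)
  next
    case False
    then have "x \<in> Q" using off[of x] x t by auto
    then show ?thesis
      using False bounds[OF x] ab t pl[of x "t - \<tau> x"] by (simp add: k'_def min_absorb2)
  qed
  ultimately show ?thesis by (auto simp: partial_lift_def)
qed


section \<open>Serre fibrations are local on the base\<close>

lemma compact_space_finite_subfamily:
  assumes "compact_space K" "\<And>x. x \<in> topspace K \<Longrightarrow> openin K (N x) \<and> x \<in> N x"
  obtains F where "finite F" "F \<subseteq> topspace K" "topspace K \<subseteq> (\<Union>x\<in>F. N x)"
proof -
  have "\<exists>\<F>. finite \<F> \<and> \<F> \<subseteq> N ` topspace K \<and> topspace K \<subseteq> \<Union>\<F>"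
    by (rule assms(1)[unfolded compact_space_alt, rule_format]) (use assms(2) in blast)
  then show ?thesis
    using that by (metis finite_subset_image)
qed

text \<open>
  Every point has a neighbourhood \<open>W\<close> inside a set \<open>Q\<close> as in \<open>partial_lift_extend\<close>, with a
  bump function that is \<open>1\<close> on \<open>W\<close> and \<open>0\<close> off \<open>Q\<close>. Finitely many \<open>W\<close> cover \<open>K\<close>; handling them one after
  the other raises \<open>\<tau>\<close> to \<open>b\<close> on each in turn.
\<close>

lemma partial_lift_slab:
  fixes K :: "'k topology" and a b :: real
  assumes K: "compact_space K" "Hausdorff_space K"
    and h: "continuous_map (prod_topology K euclideanreal) Y h"
    and nb: "neighbourhood_base_of (\<lambda>Q. closedin K Q \<and>
      (\<forall>V\<in>\<V>. homotopy_lifting (subtopology K Q)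
        (subtopology X {x \<in> topspace X. p x \<in> V}) (subtopology Y V) p)) K"
    and small: "\<And>x. x \<in> topspace K \<Longrightarrow>
      \<exists>V\<in>\<V>. \<exists>N. openin K N \<and> x \<in> N \<and> (\<forall>y\<in>N. \<forall>t\<in>{a..b}. h (y, t) \<in> V)"
    and ab: "0 \<le> a" "a \<le> b" "b \<le> 1"
    and lift: "partial_lift K X p f h (\<lambda>_. a) k"
  shows "\<exists>k'. partial_lift K X p f h (\<lambda>_. b) k'"
proof -
  define bump where "bump x W Q V u \<longleftrightarrow>
      openin K W \<and> x \<in> W \<and> closedin K Q \<and> (\<forall>y\<in>Q. \<forall>t\<in>{a..b}. h (y, t) \<in> V) \<and>
      homotopy_lifting (subtopology K Q)
        (subtopology X {x \<in> topspace X. p x \<in> V}) (subtopology Y V) p \<and>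
      continuous_map K euclideanreal u \<and> (\<forall>y\<in>topspace K. 0 \<le> u y \<and> u y \<le> 1) \<and>
      (\<forall>y\<in>W. u y = 1) \<and> (\<forall>y\<in>topspace K - Q. u y = 0)" for x W Q V and u :: "'k \<Rightarrow> real"
  have "\<exists>W Q V u. bump x W Q V u"
    if x: "x \<in> topspace K" for x
  proof -
    obtain V N where V: "V \<in> \<V>" and N: "openin K N" "x \<in> N"
      and hN: "\<forall>y\<in>N. \<forall>t\<in>{a..b}. h (y, t) \<in> V"
      using small[OF x] by blast
    obtain M Q where M: "openin K M" "x \<in> M" "M \<subseteq> Q" and Q: "closedin K Q" "Q \<subseteq> N"
      and lQ: "homotopy_lifting (subtopology K Q)
        (subtopology X {x \<in> topspace X. p x \<in> V}) (subtopology Y V) p"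
      using nb[unfolded neighbourhood_base_of, rule_format, of N x] N V by blast
    \<comment> \<open>The bump must be \<open>1\<close> on a whole neighbourhood of \<open>x\<close>, so a closed one is fitted inside \<open>M\<close>.\<close>
    have "neighbourhood_base_of (closedin K) K"
      using K by (simp add: neighbourhood_base_of_closedin compact_Hausdorff_imp_regular_space)
    then obtain W C where W: "openin K W" "x \<in> W" "W \<subseteq> C" and C: "closedin K C" "C \<subseteq> M"
      using M unfolding neighbourhood_base_of by meson
    have "normal_space K"
      using K compact_Hausdorff_or_regular_imp_normal_space by blast
    then obtain u where u: "continuous_map K (top_of_set {0..1::real}) u"
      and u0: "u ` (topspace K - M) \<subseteq> {0}" and u1: "u ` C \<subseteq> {1}"
      using Urysohn_lemma[of K "topspace K - M" C 0 1] M C by (auto simp: disjnt_iff)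
    have "0 \<le> u y \<and> u y \<le> 1" if "y \<in> topspace K" for y
      using continuous_map_funspace[OF u] that by auto
    moreover have "\<forall>y\<in>W. u y = 1" "\<forall>y\<in>topspace K - Q. u y = 0"
      using u0 u1 W M by blast+
    ultimately have "bump x W Q V u"
      using W Q hN lQ continuous_map_into_fulltopology[OF u] unfolding bump_def by blast
    then show ?thesis by blast
  qed
  then obtain W Q V u where "\<And>x. x \<in> topspace K \<Longrightarrow> bump x (W x) (Q x) (V x) (u x)"
    by metis
  then have
      W: "\<And>x. x \<in> topspace K \<Longrightarrow> openin K (W x) \<and> x \<in> W x"
    and Q: "\<And>x. x \<in> topspace K \<Longrightarrow> closedin K (Q x)"
    and hV: "\<And>x y t. x \<in> topspace K \<Longrightarrow> y \<in> Q x \<Longrightarrow> t \<in> {a..b} \<Longrightarrow> h (y, t) \<in> V x"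
    and lQ: "\<And>x. x \<in> topspace K \<Longrightarrow> homotopy_lifting (subtopology K (Q x))
        (subtopology X {z \<in> topspace X. p z \<in> V x}) (subtopology Y (V x)) p"
    and u: "\<And>x. x \<in> topspace K \<Longrightarrow> continuous_map K euclideanreal (u x)"
    and u01: "\<And>x y. x \<in> topspace K \<Longrightarrow> y \<in> topspace K \<Longrightarrow> 0 \<le> u x y \<and> u x y \<le> 1"
    and u1: "\<And>x y. x \<in> topspace K \<Longrightarrow> y \<in> W x \<Longrightarrow> u x y = 1"
    and u0: "\<And>x y. x \<in> topspace K \<Longrightarrow> y \<in> topspace K - Q x \<Longrightarrow> u x y = 0"
    unfolding bump_def by blast+
  obtain F where F: "finite F" "F \<subseteq> topspace K" "topspace K \<subseteq> (\<Union>x\<in>F. W x)"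
    using compact_space_finite_subfamily[of K W] K W by blast
  have "\<exists>\<tau> k. continuous_map K euclideanreal \<tau> \<and> (\<forall>y\<in>topspace K. a \<le> \<tau> y \<and> \<tau> y \<le> b) \<and>
      (\<forall>y\<in>topspace K. y \<in> (\<Union>x\<in>F. W x) \<longrightarrow> \<tau> y = b) \<and> partial_lift K X p f h \<tau> k"
    using F(1,2)
  proof (induction F rule: finite_induct)
    case empty
    show ?case
      using lift ab by (intro exI[of _ "\<lambda>_. a"] exI[of _ k]) auto
  next
    case (insert x F)
    then have x: "x \<in> topspace K" by simp
    obtain \<tau> k where \<tau>: "continuous_map K euclideanreal \<tau>"
      and \<tau>ab: "\<And>y. y \<in> topspace K \<Longrightarrow> a \<le> \<tau> y \<and> \<tau> y \<le> b"
      and \<tau>b: "\<And>y. y \<in> topspace K \<Longrightarrow> y \<in> (\<Union>x\<in>F. W x) \<Longrightarrow> \<tau> y = b"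
      and k: "partial_lift K X p f h \<tau> k"
      using insert by auto
    \<comment> \<open>The maximum never lowers \<open>\<tau>\<close>, equals \<open>b\<close> where the bump is \<open>1\<close>, and is \<open>\<tau>\<close> where it is \<open>0\<close>.\<close>
    define \<tau>' where "\<tau>' y = max (\<tau> y) (a + (b - a) * u x y)" for y
    have \<tau>': "continuous_map K euclideanreal \<tau>'"
      unfolding \<tau>'_def
      by (intro continuous_map_real_max continuous_map_add continuous_map_real_mult \<tau> u x) auto
    have step: "a + (b - a) * u x y \<le> b" if "y \<in> topspace K" for y
      using mult_left_mono[of "u x y" 1 "b - a"] u01[OF x that] ab by simp
    have bounds: "a \<le> \<tau> y \<and> \<tau> y \<le> \<tau>' y \<and> \<tau>' y \<le> b" if "y \<in> topspace K" for y
      using \<tau>ab[OF that] step[OF that] by (simp add: \<tau>'_def)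
    have "\<tau>' y = \<tau> y" if "y \<in> topspace K - Q x" for y
      using \<tau>ab[of y] u0[OF x that] that by (simp add: \<tau>'_def)
    then have "\<exists>k'. partial_lift K X p f h \<tau>' k'"
      using bounds hV[OF x]
      by (intro partial_lift_extend[OF k h \<tau> \<tau>' ab(1,3) _ Q[OF x] _ _ lQ[OF x]]) auto
    moreover have "\<tau>' y = b" if y: "y \<in> topspace K" "y \<in> (\<Union>x\<in>insert x F. W x)" for y
    proof (cases "y \<in> W x")
      case True
      then show ?thesis using u1[OF x True] \<tau>ab[OF y(1)] by (simp add: \<tau>'_def)
    next
      case False
      then show ?thesis using \<tau>b[OF y(1)] y bounds[OF y(1)] by force
    qed
    moreover have "a \<le> \<tau>' y \<and> \<tau>' y \<le> b" if "y \<in> topspace K" for y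
      using bounds[OF that] by linarith
    ultimately show ?case
      using \<tau>' by (intro exI[of _ \<tau>']) blast
  qed
  then obtain \<tau> k where "\<And>y. y \<in> topspace K \<Longrightarrow> \<tau> y = b" "partial_lift K X p f h \<tau> k"
    using F(3) by blast
  then show ?thesis
    using partial_lift_cong[of K \<tau> "\<lambda>_. b"] by blast
qed

text \<open>
  By the tube lemma every time \<open>t\<close> has a neighbourhood such that slabs within it are thin enough for
  the preceding lemma. Being able to pass from a lift up to time \<open>a\<close> to one up to time \<open>b\<close> is
  transitive, so bisection of \<open>[0,1]\<close> combines the slabs.
\<close>

lemma homotopy_lifting_local:
  fixes K :: "'k topology"
  assumes K: "compact_space K" "Hausdorff_space K"
    and \<V>: "\<And>V. V \<in> \<V> \<Longrightarrow> openin Y V" "\<Union>\<V> = topspace Y"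
    and nb: "neighbourhood_base_of (\<lambda>Q. closedin K Q \<and>
      (\<forall>V\<in>\<V>. homotopy_lifting (subtopology K Q)
        (subtopology X {x \<in> topspace X. p x \<in> V}) (subtopology Y V) p)) K"
  shows "homotopy_lifting K X Y p"
  unfolding homotopy_lifting_def
proof (intro allI impI, elim conjE)
  let ?I = "top_of_set {0..1::real}" and ?KR = "prod_topology K euclideanreal"
  fix f h
  assume f: "continuous_map K X f" and h: "continuous_map (prod_topology K ?I) Y h"
    and fh: "\<forall>x\<in>topspace K. p (f x) = h (x, 0)"
  define H where "H z = h (fst z, max 0 (min 1 (snd z)))" for z :: "'k \<times> real"
  have H: "continuous_map ?KR Y H"
    unfolding H_def
  proof (rule continuous_map_compose[OF _ h, unfolded o_def])
    show "continuous_map ?KR (prod_topology K ?I) (\<lambda>z. (fst z, max 0 (min 1 (snd z))))"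
      by (intro continuous_map_pairedI continuous_map_fst continuous_map_into_subtopology
          continuous_map_real_max continuous_map_real_min continuous_map_snd) auto
  qed
  have Hh: "H (x, t) = h (x, t)" if "t \<in> {0..1}" for x t
    using that by (simp add: H_def)
  let ?lift = "\<lambda>a. \<exists>k. partial_lift K X p f H (\<lambda>_. a) k"
  have lift0: "?lift 0"
  proof (intro exI)
    show "partial_lift K X p f H (\<lambda>_. 0) (\<lambda>z. f (fst z))"
      using fh Hh continuous_map_compose[OF continuous_map_under_graph_fst f, unfolded o_def]
      by (auto simp: partial_lift_def)
  qed
  \<comment> \<open>The bounds \<open>0 \<le> a\<close> and \<open>b \<le> 1\<close> are part of the relation, because the rule asks for all short
      intervals around a time \<open>t\<close>, also for those that leave \<open>[0,1]\<close>.\<close>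
  have "0 \<le> (0::real) \<and> (1::real) \<le> 1 \<longrightarrow> ?lift 0 \<longrightarrow> ?lift 1"
  proof (rule Bolzano[where P = "\<lambda>a b. 0 \<le> a \<and> b \<le> 1 \<longrightarrow> ?lift a \<longrightarrow> ?lift b"])
    fix t :: real
    have "\<exists>N d V. openin K N \<and> y \<in> N \<and> 0 < d \<and> V \<in> \<V> \<and> (\<forall>z\<in>N. \<forall>s\<in>ball t d. H (z, s) \<in> V)"
      if y: "y \<in> topspace K" for y
    proof -
      have "H (y, t) \<in> topspace Y"
        using continuous_map_funspace[OF H] y by auto
      then obtain V where V: "V \<in> \<V>" "H (y, t) \<in> V" using \<V>(2) by blast
      have "openin ?KR {z \<in> topspace ?KR. H z \<in> V}" (is "openin _ ?P")
        using H \<V>(1)[OF V(1)] by (rule openin_continuous_map_preimage)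
      then have "\<exists>N S. openin K N \<and> openin euclideanreal S \<and> y \<in> N \<and> t \<in> S \<and> N \<times> S \<subseteq> ?P"
        using y V(2) by (intro openin_prod_topology_alt[THEN iffD1, rule_format]) auto
      then obtain N S where NS: "openin K N" "open S" "y \<in> N" "t \<in> S" "N \<times> S \<subseteq> ?P"
        by auto
      then obtain d where "0 < d" "ball t d \<subseteq> S" using open_contains_ball by blast
      then show ?thesis using NS V(1) by blast
    qed
    then obtain N d V where N: "\<And>y. y \<in> topspace K \<Longrightarrow> openin K (N y) \<and> y \<in> N y"
      and d: "\<And>y. y \<in> topspace K \<Longrightarrow> 0 < d y" and V: "\<And>y. y \<in> topspace K \<Longrightarrow> V y \<in> \<V>"
      and HV: "\<And>y z s. y \<in> topspace K \<Longrightarrow> z \<in> N y \<Longrightarrow> s \<in> ball t (d y) \<Longrightarrow> H (z, s) \<in> V y"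
      by metis
    obtain F where F: "finite F" "F \<subseteq> topspace K" "topspace K \<subseteq> (\<Union>y\<in>F. N y)"
      using compact_space_finite_subfamily[of K N] K N by blast
    define \<delta> where "\<delta> = Min (insert 1 (d ` F))"
    have \<delta>: "0 < \<delta>" using F d by (auto simp: \<delta>_def)
    have \<delta>d: "\<delta> \<le> d y" if "y \<in> F" for y using F(1) that by (simp add: \<delta>_def)
    show "\<exists>\<delta>>0. \<forall>a b. a \<le> t \<and> t \<le> b \<and> b - a < \<delta> \<longrightarrow> 0 \<le> a \<and> b \<le> 1 \<longrightarrow> ?lift a \<longrightarrow> ?lift b"
    proof (intro exI[of _ \<delta>] conjI \<delta> allI impI, elim conjE exE)
      fix a b k
      assume ab: "a \<le> t" "t \<le> b" "b - a < \<delta>" "0 \<le> a" "b \<le> 1"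
        and k: "partial_lift K X p f H (\<lambda>_. a) k"
      show "?lift b"
      proof (rule partial_lift_slab[OF K H nb _ _ _ _ k])
        fix x assume "x \<in> topspace K"
        then obtain y where y: "y \<in> F" "x \<in> N y" using F(3) by blast
        have "{a..b} \<subseteq> ball t (d y)"
          using ab \<delta>d[OF y(1)] by (auto simp: dist_real_def)
        moreover have "y \<in> topspace K" using y F(2) by blast
        ultimately show "\<exists>V\<in>\<V>. \<exists>N. openin K N \<and> x \<in> N \<and> (\<forall>y\<in>N. \<forall>t\<in>{a..b}. H (y, t) \<in> V)"
          using N V HV y(2) by (meson subsetD)
      qed (use ab in auto)
    qed
  qed auto
  then obtain k where k: "partial_lift K X p f H (\<lambda>_. 1) k" using lift0 by auto
  have "continuous_map (prod_topology K ?I) (under_graph K (\<lambda>_. 1)) (\<lambda>z. (fst z, snd z))"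
    unfolding under_graph_def
    by (intro continuous_map_into_subtopology continuous_map_pairedI continuous_map_fst
        continuous_map_into_fulltopology[OF continuous_map_snd]) auto
  moreover have "continuous_map (under_graph K (\<lambda>_. 1)) X k"
    using k by (simp add: partial_lift_def)
  ultimately have "continuous_map (prod_topology K ?I) X (\<lambda>z. k (fst z, snd z))"
    by (rule continuous_map_compose[unfolded o_def])
  then show "\<exists>k. continuous_map (prod_topology K ?I) X k \<and>
      (\<forall>x\<in>topspace K. k (x, 0) = f x) \<and>
      (\<forall>x\<in>topspace K. \<forall>t\<in>{0..1}. p (k (x, t)) = h (x, t))"
    using k Hh by (intro exI[of _ k]) (auto simp: partial_lift_def)
qed

text \<open>
  Lifting against disks becomes lifting against a cube \<open>K\<close>. The small boxes in \<open>K\<close> are retracts of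
  disks up to scaling, so every Serre fibration has the lifting property for them.
\<close>

theorem serre_fibration_local:
  assumes p: "continuous_map X Y p"
    and \<V>: "\<And>V. V \<in> \<V> \<Longrightarrow> openin Y V" "\<Union>\<V> = topspace Y"
    and serre: "\<And>V. V \<in> \<V> \<Longrightarrow>
      serre_fibration (subtopology X {x \<in> topspace X. p x \<in> V}) (subtopology Y V) p"
  shows "serre_fibration X Y p"
  unfolding serre_fibration_iff
proof (intro conjI allI p)
  fix n :: nat
  let ?e = "\<lambda>i. if i < n then 1 else 0 :: real"
  let ?K = "real_box (\<lambda>i. - ?e i) ?e"
  have "neighbourhood_base_of
      (\<lambda>Q. closedin ?K Q \<and>
        (\<exists>c d. (\<forall>i<n. c i \<le> d i) \<and> (\<forall>i\<ge>n. c i = 0 \<and> d i = 0) \<and>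
          subtopology ?K Q = real_box c d)) ?K"
    by (rule neighbourhood_base_of_sub_boxes) simp
  then have "neighbourhood_base_of (\<lambda>Q. closedin ?K Q \<and>
      (\<forall>V\<in>\<V>. homotopy_lifting (subtopology ?K Q)
        (subtopology X {x \<in> topspace X. p x \<in> V}) (subtopology Y V) p)) ?K"
  proof (rule neighbourhood_base_of_mono, elim conjE exE)
    fix Q c d
    assume Q: "closedin ?K Q" and cd: "\<forall>i<n. c i \<le> d i" "\<forall>i\<ge>n. c i = 0 \<and> d i = 0"
      and eq: "subtopology ?K Q = real_box c d"
    show "closedin ?K Q \<and> (\<forall>V\<in>\<V>. homotopy_lifting (subtopology ?K Q)
        (subtopology X {x \<in> topspace X. p x \<in> V}) (subtopology Y V) p)"
      unfolding eq using Q cd serre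
      by (auto simp: serre_fibration_iff intro!: homotopy_lifting_real_box[of n])
  qed
  then have "homotopy_lifting ?K X Y p"
    using \<V> by (intro homotopy_lifting_local[OF compact_space_real_box Hausdorff_space_real_box])
  then show "homotopy_lifting (disk n) X Y p"
    by (rule homotopy_lifting_disk)
qed


section \<open>Passage to fixed points\<close>

theorem theorem4p5:
  fixes G :: "('g, 'm) monoid_scheme" and T :: "'g topology"
    and n :: nat and A :: "'g chart set"
    and \<C> :: "'g set set"
    and X :: "'x topology" and actX :: "'g \<Rightarrow> 'x \<Rightarrow> 'x"
    and Y :: "'y topology" and actY :: "'g \<Rightarrow> 'y \<Rightarrow> 'y"
    and p :: "'x \<Rightarrow> 'y"
    and I :: "'i set" and U :: "'i \<Rightarrow> 'y set"
  assumes "lie_group G T n A" and "compact_space T"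
    and "\<C> \<subseteq> closed_subgroups G T" and "closed_under_conjugacy G \<C>"
    and "G_space G T X actX" and "G_space G T Y actY"
    and "G_map G X actX Y actY p"
    and "\<And>i. i \<in> I \<Longrightarrow> openin Y (U i)"
    and "\<And>i. i \<in> I \<Longrightarrow> G_invariant G actY (U i)"
    and "(\<Union>i\<in>I. U i) = topspace Y"
    and "\<And>i. i \<in> I \<Longrightarrow>
      C_fibration G \<C>
        (subtopology X {x \<in> topspace X. p x \<in> U i}) actX
        (subtopology Y (U i)) actY p"
  shows "C_fibration G \<C> X actX Y actY p"
  unfolding C_fibration_def
proof (intro conjI ballI)
  show "G_map G X actX Y actY p" by fact
  fix H assume H: "H \<in> \<C>"
  have HG: "H \<subseteq> carrier G"
    using H assms(3) by (auto simp: closed_subgroups_def dest: subgroup.subset)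
  let ?X = "fixed_points H X actX" and ?Y = "fixed_points H Y actY"
  have p: "continuous_map X Y p"
    and equi: "\<And>g x. g \<in> carrier G \<Longrightarrow> x \<in> topspace X \<Longrightarrow> p (actX g x) = actY g (p x)"
    using assms(7) by (auto simp: G_map_def)
  have pY: "p x \<in> topspace Y" if "x \<in> topspace X" for x
    using continuous_map_funspace[OF p] that by auto
  \<comment> \<open>By equivariance \<open>p\<close> maps \<open>X\<^sup>H\<close> to \<open>Y\<^sup>H\<close>; this also needs that \<open>H\<close> lies in \<open>G\<close>.\<close>
  have pH: "p x \<in> topspace ?Y" if "x \<in> topspace ?X" for x
    using that pY equi HG by (fastforce simp: fixed_points_def)
  show "serre_fibration ?X ?Y p"
  proof (rule serre_fibration_local[where \<V> = "(\<lambda>i. topspace ?Y \<inter> U i) ` I"])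
    show "continuous_map ?X ?Y p"
      unfolding fixed_points_def
      by (intro continuous_map_into_subtopology continuous_map_from_subtopology[OF p])
        (use pH in \<open>auto simp: fixed_points_def\<close>)
    show "\<Union> ((\<lambda>i. topspace ?Y \<inter> U i) ` I) = topspace ?Y"
      using assms(10) by (auto simp: fixed_points_def)
    fix V assume "V \<in> (\<lambda>i. topspace ?Y \<inter> U i) ` I"
    then obtain i where i: "i \<in> I" and V: "V = topspace ?Y \<inter> U i" by blast
    show "openin ?Y V"
      unfolding V fixed_points_def openin_subtopology
      by (rule exI[of _ "U i"]) (use assms(8)[OF i] in \<open>auto dest: openin_subset\<close>)
    have "serre_fibration
        (fixed_points H (subtopology X {x \<in> topspace X. p x \<in> U i}) actX)
        (fixed_points H (subtopology Y (U i)) actY) p"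
      using assms(11)[OF i] H by (simp add: C_fibration_def)
    also have "fixed_points H (subtopology X {x \<in> topspace X. p x \<in> U i}) actX =
        subtopology ?X {x \<in> topspace ?X. p x \<in> V}"
      unfolding fixed_points_def subtopology_subtopology V
      using pH by (intro arg_cong2[where f = subtopology]) (auto simp: fixed_points_def)
    also have "fixed_points H (subtopology Y (U i)) actY = subtopology ?Y V"
      unfolding fixed_points_def subtopology_subtopology V
      by (intro arg_cong2[where f = subtopology]) auto
    finally show "serre_fibration (subtopology ?X {x \<in> topspace ?X. p x \<in> V}) (subtopology ?Y V) p" .
  qed
qed

end
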